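(* Let $f,g:(a,b)\to\mathbb{R}$ be smooth functions such that $h:=f-g$ is nowhere zero, and let $M^2$ be the surface of revolution in $E_1^3$ (with lightlike axis spanned by $(0,1,1)$) parametrized by $$\boldsymbol{x}(s,\theta)=\Big(\theta h(s),\; g(s)+\tfrac12\theta^2h(s),\; f(s)+\tfrac12\theta^2h(s)\Big),\qquad s\in(a,b),\ \theta\in\mathbb{R}.$$ Assume that $M^2$ is non-degenerate with nowhere vanishing Gauss curvature. Then there exists a real $3\times 3$ matrix $A$ with $\Delta^{III}\boldsymbol{x}=A\boldsymbol{x}$ on $M^2$ if and only if one of the following holds: (i) $M^2$ has zero mean curvature (identically); (ii) $M^2$ is an open piece of the pseudosphere $\mathbb{S}^2_1(0,c)$ for some $c>0$; (iii) $M^2$ is an open piece of the hyperbolic space $\mathbb{H}^2(0,c)$ for some $c>0$.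
   Context: $E_1^3$ is $\mathbb{R}^3$ with coordinates $(x,y,z)$ and the Lorentzian metric $\langle\cdot,\cdot\rangle=dx^2+dy^2-dz^2$. For a parametrized surface $\boldsymbol{x}(s,\theta)$ in $E_1^3$, put $E=\langle \boldsymbol{x}_s,\boldsymbol{x}_s\rangle$, $F=\langle \boldsymbol{x}_s,\boldsymbol{x}_\theta\rangle$, $G=\langle \boldsymbol{x}_\theta,\boldsymbol{x}_\theta\rangle$. The surface is non-degenerate if $EG-F^2\neq 0$ everywhere; then $\boldsymbol{n}$ denotes a unit normal field ($\langle\boldsymbol{n},\boldsymbol{n}\rangle=\pm1$), and the second fundamental form has coefficients $L=\langle \boldsymbol{x}_{ss},\boldsymbol{n}\rangle$, $M=\langle \boldsymbol{x}_{s\theta},\boldsymbol{n}\rangle$, $N=\langle \boldsymbol{x}_{\theta\theta},\boldsymbol{n}\rangle$. Nowhere vanishing Gauss curvature means $LN-M^2\neq0$ everywhere (no parabolic points). Zero mean curvature means $EN-2FM+GL=0$ identically. The third fundamental form $III$ has coefficients $e_{11}=\langle\boldsymbol{n}_s,\boldsymbol{n}_s\rangle$, $e_{12}=e_{21}=\langle\boldsymbol{n}_s,\boldsymbol{n}_\theta\rangle$, $e_{22}=\langle\boldsymbol{n}_\theta,\boldsymbol{n}_\theta\rangle$; it is non-degenerate when $LN-M^2\ne0$. With $e=\det(e_{km})$, $(e^{km})$ the inverse matrix of $(e_{km})$ and $(u^1,u^2)=(s,\theta)$, the Laplace operator with respect to $III$ is $$\Delta^{III}p=-\frac{1}{\sqrt{|e|}}\sum_{k,m}\frac{\partial}{\partial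 u^m}\Big(\sqrt{|e|}\,e^{km}\frac{\partial p}{\partial u^k}\Big)$$ for smooth functions $p$, and $\Delta^{III}\boldsymbol{x}$ is defined componentwise. $\mathbb{S}_1^2(0,c)=\{x^2+y^2-z^2=c^2\}$ and $\mathbb{H}^2(0,c)=\{x^2+y^2-z^2=-c^2\}$. *)

theory Defs
  imports "HOL-Analysis.Analysis"
begin

definition lorentz :: "real^3 \<Rightarrow> real^3 \<Rightarrow> real" where
  "lorentz v w = v $ 1 * w $ 1 + v $ 2 * w $ 2 - v $ 3 * w $ 3"

definition pseudosphere :: "real \<Rightarrow> (real^3) set" where
  "pseudosphere c = {p. lorentz p p = c^2}"

text \<open>Both sheets of the hyperboloid are included.\<close>

definition hyperbolic_space :: "real \<Rightarrow> (real^3) set" where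
  "hyperbolic_space c = {p. lorentz p p = - (c^2)}"

text \<open>Only meaningful for an open set \<open>I\<close>, where \<^const>\<open>deriv\<close> does not depend on the values
  of the function outside \<open>I\<close>.\<close>

definition smooth_fun_on :: "real set \<Rightarrow> (real \<Rightarrow> real) \<Rightarrow> bool" where
  "smooth_fun_on I f \<longleftrightarrow> (\<forall>n. \<forall>s\<in>I. (deriv ^^ n) f differentiable (at s))"

text \<open>The type \<open>2\<close> indexes the parameters: index \<open>1\<close> is \<open>s\<close>, index \<open>2\<close> is \<open>\<theta>\<close>.\<close>

definition partial ::
  "2 \<Rightarrow> (real \<Rightarrow> real \<Rightarrow> 'a::real_normed_vector) \<Rightarrow> real \<Rightarrow> real \<Rightarrow> 'a" where
  "partial k p s t =
     (if k = 1 then vector_derivative (\<lambda>r. p r t) (at s)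
      else vector_derivative (\<lambda>r. p s r) (at t))"

definition first_form :: "(real \<Rightarrow> real \<Rightarrow> real^3) \<Rightarrow> real \<Rightarrow> real \<Rightarrow> real^2^2" where
  "first_form x s t = (\<chi> k m. lorentz (partial k x s t) (partial m x s t))"

definition second_form ::
  "(real \<Rightarrow> real \<Rightarrow> real^3) \<Rightarrow> (real \<Rightarrow> real \<Rightarrow> real^3) \<Rightarrow> real \<Rightarrow> real \<Rightarrow> real^2^2" where
  "second_form x n s t = (\<chi> k m. lorentz (partial m (partial k x) s t) (n s t))"

definition third_form :: "(real \<Rightarrow> real \<Rightarrow> real^3) \<Rightarrow> real \<Rightarrow> real \<Rightarrow> real^2^2" where
  "third_form n s t = (\<chi> k m. lorentz (partial k n s t) (partial m n s t))"

definition nondegenerate_on :: "(real \<times> real) set \<Rightarrow> (real \<Rightarrow> real \<Rightarrow> real^3) \<Rightarrow> bool" where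
  "nondegenerate_on U x \<longleftrightarrow>
     (\<forall>(s, t)\<in>U.
        first_form x s t $ 1 $ 1 * first_form x s t $ 2 $ 2 - (first_form x s t $ 1 $ 2)^2 \<noteq> 0)"

text \<open>On a smooth non-degenerate surface a continuous unit normal field is automatically smooth.\<close>

definition unit_normal_field_on ::
  "(real \<times> real) set \<Rightarrow> (real \<Rightarrow> real \<Rightarrow> real^3) \<Rightarrow> (real \<Rightarrow> real \<Rightarrow> real^3) \<Rightarrow> bool" where
  "unit_normal_field_on U x n \<longleftrightarrow>
     continuous_on U (\<lambda>(s, t). n s t) \<and>
     (\<forall>(s, t)\<in>U.
        (lorentz (n s t) (n s t) = 1 \<or> lorentz (n s t) (n s t) = -1) \<and>
        (\<forall>k. lorentz (n s t) (partial k x s t) = 0))"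

definition no_parabolic_points_on ::
  "(real \<times> real) set \<Rightarrow> (real \<Rightarrow> real \<Rightarrow> real^3) \<Rightarrow> (real \<Rightarrow> real \<Rightarrow> real^3) \<Rightarrow> bool" where
  "no_parabolic_points_on U x n \<longleftrightarrow>
     (\<forall>(s, t)\<in>U.
        second_form x n s t $ 1 $ 1 * second_form x n s t $ 2 $ 2
          - (second_form x n s t $ 1 $ 2)^2 \<noteq> 0)"

definition zero_mean_curvature_on ::
  "(real \<times> real) set \<Rightarrow> (real \<Rightarrow> real \<Rightarrow> real^3) \<Rightarrow> (real \<Rightarrow> real \<Rightarrow> real^3) \<Rightarrow> bool" where
  "zero_mean_curvature_on U x n \<longleftrightarrow>
     (\<forall>(s, t)\<in>U.
        first_form x s t $ 1 $ 1 * second_form x n s t $ 2 $ 2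
          - 2 * first_form x s t $ 1 $ 2 * second_form x n s t $ 1 $ 2
          + first_form x s t $ 2 $ 2 * second_form x n s t $ 1 $ 1 = 0)"

definition laplace_III ::
  "(real \<Rightarrow> real \<Rightarrow> real^3) \<Rightarrow> (real \<Rightarrow> real \<Rightarrow> real) \<Rightarrow> real \<Rightarrow> real \<Rightarrow> real" where
  "laplace_III n p s t =
     - (1 / sqrt \<bar>det (third_form n s t)\<bar>) *
       (\<Sum>k\<in>UNIV. \<Sum>m\<in>UNIV.
          partial m
            (\<lambda>s t. sqrt \<bar>det (third_form n s t)\<bar> * matrix_inv (third_form n s t) $ k $ m
                     * partial k p s t) s t)"

definition laplace_III_vec ::
  "(real \<Rightarrow> real \<Rightarrow> real^3) \<Rightarrow> (real \<Rightarrow> real \<Rightarrow> real^3) \<Rightarrow> real \<Rightarrow> real \<Rightarrow> real^3" where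
  "laplace_III_vec n x s t = (\<chi> i. laplace_III n (\<lambda>s t. x s t $ i) s t)"

definition lightlike_revolution ::
  "(real \<Rightarrow> real) \<Rightarrow> (real \<Rightarrow> real) \<Rightarrow> real \<Rightarrow> real \<Rightarrow> real^3" where
  "lightlike_revolution f g s t =
     (let h = f s - g s
      in vector [t * h, g s + 1/2 * t^2 * h, f s + 1/2 * t^2 * h])"

text \<open>Unit normal fields exist on every non-degenerate \<open>C\<^sup>1\<close> surface: normalise the Lorentzian
  cross product of the coordinate tangent vectors.\<close>

lemma unit_normal_field_exists:
  assumes c: "\<And>k. continuous_on U (\<lambda>(s, t). partial k x s t)"
    and nd: "nondegenerate_on U x"
  shows "\<exists>n. unit_normal_field_on U x n"
proof -
  define w :: "real \<Rightarrow> real \<Rightarrow> real^3" where "w s t =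
     (let a = partial 1 x s t; b = partial 2 x s t in
      vector [a$2*b$3 - a$3*b$2, a$3*b$1 - a$1*b$3, a$2*b$1 - a$1*b$2])" for s t
  have w: "w s t $ 1 = partial 1 x s t $2 * partial 2 x s t $3 - partial 1 x s t $3 * partial 2 x s t $2"
          "w s t $ 2 = partial 1 x s t $3 * partial 2 x s t $1 - partial 1 x s t $1 * partial 2 x s t $3"
          "w s t $ 3 = partial 1 x s t $2 * partial 2 x s t $1 - partial 1 x s t $1 * partial 2 x s t $2"
    for s t by (simp_all add: w_def Let_def vector_3)
  define q where "q s t = lorentz (w s t) (w s t)" for s t
  have q: "q s t = - (first_form x s t $ 1 $ 1 * first_form x s t $ 2 $ 2 - (first_form x s t $ 1 $ 2)^2)"
    for s t unfolding q_def lorentz_def w first_form_def by (simp add: lorentz_def) algebra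
  have q0: "q s t \<noteq> 0" if "(s, t) \<in> U" for s t
    using nd that unfolding q nondegenerate_on_def by auto
  define n where "n s t = (1 / sqrt \<bar>q s t\<bar>) *\<^sub>R w s t" for s t
  have c': "continuous_on U (\<lambda>z. partial k x (fst z) (snd z) $ i)" for k i
    using c[of k] by (auto intro!: continuous_intros simp: case_prod_beta')
  have cw: "continuous_on U (\<lambda>z. w (fst z) (snd z))"
  proof -
    have "continuous_on U (\<lambda>z. w (fst z) (snd z) $ i)" for i
      using exhaust_3[of i]
      by (elim disjE) (simp_all only: w, (intro continuous_intros c')+)
    then have "continuous_on U (\<lambda>z. \<chi> i. w (fst z) (snd z) $ i)"
      by (intro continuous_on_vec_lambda)
    then show ?thesis by simp
  qed
  have "continuous_on U (\<lambda>(s, t). n s t)"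
    using q0 unfolding n_def q_def lorentz_def case_prod_beta'
    by (auto intro!: continuous_intros cw)
  moreover have "lorentz (n s t) (n s t) = q s t / \<bar>q s t\<bar>" for s t
    by (simp add: n_def lorentz_def q_def diff_divide_distrib add_divide_distrib)
  moreover have "lorentz (n s t) (partial k x s t) = 0" for s t k
  proof -
    have "lorentz (w s t) (partial k x s t) = 0"
      using exhaust_2[of k] by (auto simp: lorentz_def w algebra_simps)
    then show ?thesis
      by (simp add: n_def lorentz_def diff_divide_distrib[symmetric] add_divide_distrib[symmetric])
  qed
  ultimately show ?thesis
    using q0 unfolding unit_normal_field_on_def by (intro exI[of _ n]) (auto simp: abs_if)
qed

end

theory Submission
  imports Defs
begin

text \<open>
  In the null coordinates \<open>X = x\<close>, \<open>p = z - y\<close>, \<open>q = z + y\<close> the surface consists of the orbits of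
  the profile curve \<open>(h, w)\<close>, \<open>h = f - g\<close> and \<open>w = f + g\<close>, under the null rotations about the axis.
  The unit normal is null-rotational as well, with a profile \<open>(\<alpha>, -\<epsilon>/\<alpha>)\<close> where \<open>\<epsilon> = \<plusminus>1\<close>
  (\<open>null_rotation_surface_of_unit_normal\<close>). Orthogonality reads \<open>w' \<alpha>\<^sup>2 = \<epsilon> h'\<close>, and
  \<open>\<alpha>'\<close> is nowhere zero because there are no parabolic points. So \<open>\<alpha>\<close> may
  replace \<open>s\<close> as a parameter, and \<open>III = -\<epsilon> d\<alpha>\<^sup>2/\<alpha>\<^sup>2 + \<alpha>\<^sup>2 dt\<^sup>2\<close> becomes a fixed metric, with
  \<open>\<Delta>\<^sup>I\<^sup>I\<^sup>I = \<epsilon> \<partial>\<^sub>\<alpha> \<alpha>\<^sup>2 \<partial>\<^sub>\<alpha> - \<alpha>\<^sup>-\<^sup>2 \<partial>\<^sub>t\<^sup>2\<close>; the profile curve is the only unknown left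
  (\<open>laplace_III_quadratic\<close>, \<open>laplace_III_vec_x\<close>).

  A matrix relation \<open>\<Delta>\<^sup>I\<^sup>I\<^sup>I x = A x\<close> amounts to two ordinary differential equations
  with constants \<open>\<kappa> = \<epsilon> \<nu>\<close> and \<open>\<mu>\<close> (\<open>null_orbit_linear_iff\<close>). With derivatives taken with respect
  to \<open>\<alpha>\<close>, they are \<open>(\<alpha>\<^sup>2 h')' = \<nu> h\<close> and \<open>h'' - 2h/\<alpha>\<^sup>2 = \<mu> h + \<kappa> w\<close>, to be combined with
  \<open>w' = \<epsilon> h'/\<alpha>\<^sup>2\<close>. The system is overdetermined. Writing \<open>P = \<alpha>\<^sup>2 h'\<close>, two differentiations of
  the second equation give
    \<open>P (4 - \<mu> \<alpha>\<^sup>2) = 4 (\<nu> - 1) h \<alpha>\<close> and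
    \<open>h \<alpha> (4 - \<mu> \<nu> \<alpha>\<^sup>2) = P (4 (\<nu> - 1) + 2 \<mu> \<alpha>\<^sup>2)\<close>.
  Multiplying these and cancelling \<open>P h \<alpha>\<close>, which is nonzero, one obtains a polynomial
  equation for \<open>\<alpha>\<^sup>2\<close>, all of whose coefficients must vanish. This leaves \<open>\<mu> = 0\<close> and \<open>\<nu> = 0\<close> or
  \<open>\<nu> = 2\<close> (\<open>eigenvalue_cases\<close>). For \<open>\<nu> = 0\<close> the product \<open>h \<alpha>\<close> is constant, which is the equation
  of zero mean curvature; for \<open>\<nu> = 2\<close> the quotient \<open>h / \<alpha>\<close> is constant and \<open>h w\<close> is a nonzero
  constant. As \<open>-h w\<close> is the value of the Lorentzian form at the points of the surface, the
  surface then lies on a pseudosphere or a hyperbolic space, and it is open there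
  (\<open>openin_quadric_null_orbits_iff\<close>). The converse is a direct computation
  (\<open>laplace_eigen_iff\<close>).
\<close>

section \<open>Null coordinates\<close>

text \<open>The coordinates \<open>X = x\<close>, \<open>p = z - y\<close>, \<open>q = z + y\<close>, in which the Lorentzian form is
  \<open>X\<^sup>2 - p q\<close>: the axis of rotation becomes the \<open>q\<close>-axis.\<close>

definition null_vec :: "real \<Rightarrow> real \<Rightarrow> real \<Rightarrow> real^3" where
  "null_vec X p q = vector [X, (q - p) / 2, (q + p) / 2]"

text \<open>The null rotation \<open>(X, p, q) \<mapsto> (X + t p, p, q + 2 t X + t\<^sup>2 p)\<close> about the axis, applied to the
  point \<open>(0, u, v)\<close> of the plane \<open>x = 0\<close>.\<close>

definition null_orbit :: "real \<Rightarrow> real \<Rightarrow> real \<Rightarrow> real^3" where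
  "null_orbit u v t = null_vec (t * u) u (v + t\<^sup>2 * u)"

lemma null_vec_nth [simp]:
  "null_vec X p q $ 1 = X" "null_vec X p q $ 2 = (q - p) / 2" "null_vec X p q $ 3 = (q + p) / 2"
  by (simp_all add: null_vec_def)

lemma null_vec_inject: "null_vec X p q = null_vec X' p' q' \<longleftrightarrow> X = X' \<and> p = p' \<and> q = q'"
  by (auto simp: vec_eq_iff forall_3)

lemma null_vec_surj: "\<exists>X p q. v = null_vec X p q"
proof (intro exI)
  show "v = null_vec (v $ 1) (v $ 3 - v $ 2) (v $ 3 + v $ 2)"
    by (auto simp: vec_eq_iff forall_3 field_simps)
qed

lemma null_vec_decompose:
  "null_vec X p q = X *\<^sub>R null_vec 1 0 0 + p *\<^sub>R null_vec 0 1 0 + q *\<^sub>R null_vec 0 0 1"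
  by (auto simp: vec_eq_iff forall_3 field_simps)

lemma has_vector_derivative_null_vec:
  assumes "(X has_real_derivative X') (at s)" "(p has_real_derivative p') (at s)"
    and "(q has_real_derivative q') (at s)"
  shows "((\<lambda>r. null_vec (X r) (p r) (q r)) has_vector_derivative null_vec X' p' q') (at s)"
proof -
  have "((\<lambda>r. X r *\<^sub>R null_vec 1 0 0 + p r *\<^sub>R null_vec 0 1 0 + q r *\<^sub>R null_vec 0 0 1)
      has_vector_derivative
      X' *\<^sub>R null_vec 1 0 0 + p' *\<^sub>R null_vec 0 1 0 + q' *\<^sub>R null_vec 0 0 1) (at s)"
    using assms by (auto intro!: derivative_eq_intros)
  then show ?thesis
    by (simp only: null_vec_decompose[symmetric])
qed

lemma has_vector_derivative_null_orbit:
  assumes "(u has_real_derivative u') (at s)" "(v has_real_derivative v') (at s)"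
  shows "((\<lambda>r. null_orbit (u r) (v r) t) has_vector_derivative null_orbit u' v' t) (at s)"
  unfolding null_orbit_def
  by (rule has_vector_derivative_null_vec) (use assms in \<open>auto intro!: derivative_eq_intros\<close>)

lemma has_vector_derivative_null_orbit_parameter:
  "(null_orbit u v has_vector_derivative null_vec u 0 (2 * t * u)) (at t)"
  unfolding null_orbit_def
  by (rule has_vector_derivative_null_vec) (auto intro!: derivative_eq_intros)

lemma lorentz_null_vec:
  "lorentz (null_vec X p q) (null_vec X' p' q') = X * X' - (p * q' + q * p') / 2"
  by (simp add: lorentz_def field_simps)

lemma lorentz_null_orbit:
  "lorentz (null_orbit u v t) (null_orbit u' v' t) = - (u * v' + v * u') / 2"
  by (simp add: null_orbit_def lorentz_null_vec power2_eq_square field_simps)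

lemma lorentz_null_orbit_tangent:
  "lorentz (null_orbit u v t) (null_vec w 0 (2 * t * w)) = 0"
  "lorentz (null_vec w 0 (2 * t * w)) (null_orbit u v t) = 0"
  by (simp_all add: null_orbit_def lorentz_null_vec)

text \<open>The velocity of a null orbit at time \<open>t\<close> spans the normal direction of the rotated plane
  \<open>x = 0\<close>, so whatever is orthogonal to it lies in that plane and is itself the position at
  time \<open>t\<close> of an orbit. Applied to a normal vector, this shows that the Gauss map of a
  surface of revolution is again null-rotational.\<close>

lemma null_orbit_surj_if_orthogonal:
  assumes "w \<noteq> 0" "lorentz y (null_vec w 0 (2 * t * w)) = 0"
  shows "y = null_orbit (y $ 3 - y $ 2) (y $ 3 + y $ 2 - t\<^sup>2 * (y $ 3 - y $ 2)) t"
proof -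
  obtain X p q where y: "y = null_vec X p q"
    using null_vec_surj by blast
  have "w * X = w * (t * p)"
    using assms(2) by (simp add: y lorentz_null_vec mult_ac)
  then have X: "X = t * p"
    using assms(1) by simp
  show ?thesis
    unfolding null_orbit_def y X by (simp add: null_vec_inject field_simps)
qed

lemma lightlike_revolution_eq_null_orbit:
  "lightlike_revolution f g s t = null_orbit (f s - g s) (f s + g s) t"
  by (auto simp: lightlike_revolution_def null_orbit_def vec_eq_iff forall_3 Let_def field_simps)

section \<open>Preliminaries from calculus and linear algebra\<close>

lemma partial_1_eqI:
  assumes "open I" "s \<in> I" "\<And>r. r \<in> I \<Longrightarrow> p r t = q r" "(q has_vector_derivative d) (at s)"
  shows "partial 1 p s t = d"
proof -
  have "((\<lambda>r. p r t) has_vector_derivative d) (at s)"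
    by (rule has_vector_derivative_transform_within_open[OF assms(4,1,2)]) (simp add: assms(3))
  then show ?thesis
    by (simp add: partial_def vector_derivative_at)
qed

lemma partial_2_eqI:
  assumes "\<And>r. p s r = q r" "(q has_vector_derivative d) (at t)"
  shows "partial 2 p s t = d"
proof -
  have "p s = q"
    using assms(1) by blast
  then show ?thesis
    using assms(2) by (simp add: partial_def vector_derivative_at)
qed

lemma matrix_inv_diagonal_2:
  fixes T :: "real^2^2"
  assumes "T $ 1 $ 1 \<noteq> 0" "T $ 2 $ 2 \<noteq> 0" "T $ 1 $ 2 = 0" "T $ 2 $ 1 = 0"
  shows "matrix_inv T $ 1 $ 1 = 1 / T $ 1 $ 1" "matrix_inv T $ 2 $ 2 = 1 / T $ 2 $ 2"
    and "matrix_inv T $ 1 $ 2 = 0" "matrix_inv T $ 2 $ 1 = 0"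
proof -
  have "det T \<noteq> 0"
    using assms by (simp add: det_2)
  then have "T ** matrix_inv T = mat 1"
    using invertible_det_nz[of T] invertible_def matrix_inv_def by (metis (mono_tags, lifting) someI_ex)
  then have *: "(T ** matrix_inv T) $ i $ j = (mat 1 :: real^2^2) $ i $ j" for i j
    by simp
  show "matrix_inv T $ 1 $ 1 = 1 / T $ 1 $ 1" "matrix_inv T $ 2 $ 2 = 1 / T $ 2 $ 2"
    and "matrix_inv T $ 1 $ 2 = 0" "matrix_inv T $ 2 $ 1 = 0"
    using *[of 1 1] *[of 2 2] *[of 1 2] *[of 2 1] assms
    by (simp_all add: matrix_matrix_mult_def sum_2 mat_def field_simps)
qed

lemma derivative_of_zero:
  fixes F :: "real \<Rightarrow> real"
  assumes "open I" "s \<in> I" "\<And>r. r \<in> I \<Longrightarrow> F r = 0" "(F has_real_derivative d) (at s)"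
  shows "d = 0"
proof -
  have "((\<lambda>_. 0) has_real_derivative d) (at s)"
    by (rule has_field_derivative_transform_within_open[OF assms(4,1,2)]) (simp add: assms(3))
  then show ?thesis
    using DERIV_unique[OF _ DERIV_const] by blast
qed

lemma connected_nonzero_constant_sign:
  fixes F :: "'a::topological_space \<Rightarrow> real"
  assumes "connected S" "continuous_on S F" "\<And>x. x \<in> S \<Longrightarrow> F x \<noteq> 0"
  shows "\<exists>\<sigma>. (\<sigma> = 1 \<or> \<sigma> = -1) \<and> (\<forall>x\<in>S. \<bar>F x\<bar> = \<sigma> * F x)"
proof -
  have "connected (F ` S)"
    using assms by (intro connected_continuous_image)
  have "0 \<notin> F ` S"
    using assms(3) by force
  then have "(\<forall>x\<in>S. F x > 0) \<or> (\<forall>x\<in>S. F x < 0)"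
    using connectedD_interval[OF \<open>connected (F ` S)\<close>, of _ _ 0] assms(3)
    by (metis imageI less_eq_real_def not_le)
  then show ?thesis
  proof
    assume "\<forall>x\<in>S. F x > 0"
    then show ?thesis
      by (intro exI[of _ 1]) auto
  next
    assume "\<forall>x\<in>S. F x < 0"
    then show ?thesis
      by (intro exI[of _ "-1"]) auto
  qed
qed

text \<open>Dividing the derivative of the relation by \<open>z'\<close> lowers its degree.\<close>

lemma quadratic_vanishing_coefficients:
  fixes z :: "real \<Rightarrow> real"
  assumes "open I" "I \<noteq> {}" "\<And>s. s \<in> I \<Longrightarrow> (z has_real_derivative z1 s) (at s)"
    and "\<And>s. s \<in> I \<Longrightarrow> z1 s \<noteq> 0" "\<And>s. s \<in> I \<Longrightarrow> c0 + c1 * z s + c2 * (z s)\<^sup>2 = 0"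
  shows "c0 = 0" "c1 = 0" "c2 = 0"
proof -
  have 1: "c1 + 2 * c2 * z s = 0" if "s \<in> I" for s
  proof -
    have "((\<lambda>r. c0 + c1 * z r + c2 * (z r)\<^sup>2) has_real_derivative (c1 + 2 * c2 * z s) * z1 s) (at s)"
      by (auto intro!: derivative_eq_intros assms(3) that simp: algebra_simps)
    from derivative_of_zero[OF assms(1) that _ this] assms(4,5) that show ?thesis
      by simp
  qed
  have 2: "c2 = 0" if "s \<in> I" for s
  proof -
    have "((\<lambda>r. c1 + 2 * c2 * z r) has_real_derivative 2 * c2 * z1 s) (at s)"
      by (auto intro!: derivative_eq_intros assms(3) that)
    from derivative_of_zero[OF assms(1) that _ this] 1 assms(4) that show ?thesis
      by simp
  qed
  obtain s where "s \<in> I"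
    using assms(2) by blast
  with 1 2 assms(5)[of s] show "c0 = 0" "c1 = 0" "c2 = 0"
    by auto
qed

text \<open>A nonzero derivative is an invertible linear map, so \<open>h\<close> is open near each point of \<open>I\<close>.\<close>

lemma open_image_nonzero_derivative:
  fixes h :: "real \<Rightarrow> real"
  assumes "open I" "\<And>s. s \<in> I \<Longrightarrow> (h has_real_derivative h1 s) (at s)" "\<And>s. s \<in> I \<Longrightarrow> h1 s \<noteq> 0"
  shows "open (h ` I)"
proof -
  have "continuous_on I h"
    using assms(2) by (meson DERIV_isCont continuous_at_imp_continuous_on)
  have "h s \<in> interior (h ` I)" if "s \<in> I" for s
  proof (rule sussmann_open_mapping[OF assms(1) \<open>continuous_on I h\<close> that])
    show "(h has_derivative (\<lambda>x. x * h1 s)) (at s)"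
      using assms(2)[OF that] by (simp add: has_field_derivative_def mult_commute_abs)
    show "bounded_linear (\<lambda>x. x / h1 s)"
      by (rule bounded_linear_divide)
    show "(\<lambda>x. x * h1 s) \<circ> (\<lambda>x. x / h1 s) = id"
      using assms(3)[OF that] by (auto simp: fun_eq_iff)
  qed (use that assms(1) in \<open>auto simp: interior_open\<close>)
  then have "h ` I \<subseteq> interior (h ` I)"
    by blast
  then show ?thesis
    by (metis interior_subset open_interior subset_antisym)
qed

lemma smooth_fun_on_derivatives:
  assumes "smooth_fun_on I f" "s \<in> I"
  shows "((deriv ^^ n) f has_real_derivative (deriv ^^ Suc n) f s) (at s)"
  using assms by (simp add: smooth_fun_on_def DERIV_deriv_iff_real_differentiable)

section \<open>A null-rotational surface and its Gauss map\<close>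

text \<open>The orbits of a profile curve \<open>(h, w)\<close>, together with a unit normal. By the orthogonality to
  the orbits the normal is an orbit \<open>(\<alpha>, \<beta>)\<close> at the same time \<open>t\<close>; its length gives
  \<open>\<alpha> \<beta> = -\<epsilon>\<close>, and orthogonality to the profile curve, \<open>h' \<beta> + w' \<alpha> = 0\<close>, then becomes the
  assumption \<open>orthogonal\<close>. The function \<open>\<alpha>\<close> serves as a parameter of the Gauss map, and this
  assumption says \<open>dw/d\<alpha> = \<epsilon> (dh/d\<alpha>) / \<alpha>\<^sup>2\<close>.\<close>

locale null_rotation_surface =
  fixes I :: "real set"
    and h h1 h2 w w1 w2 \<alpha> \<alpha>1 \<alpha>2 :: "real \<Rightarrow> real"
    and \<epsilon> :: real
    and x n :: "real \<Rightarrow> real \<Rightarrow> real^3"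
  assumes I: "open I" "connected I" "I \<noteq> {}"
    and \<epsilon>: "\<epsilon> = 1 \<or> \<epsilon> = -1"
    and x: "\<And>s t. x s t = null_orbit (h s) (w s) t"
    and n: "\<And>s t. s \<in> I \<Longrightarrow> n s t = null_orbit (\<alpha> s) (- \<epsilon> / \<alpha> s) t"
    and h: "\<And>s. s \<in> I \<Longrightarrow> (h has_real_derivative h1 s) (at s)"
    and h1: "\<And>s. s \<in> I \<Longrightarrow> (h1 has_real_derivative h2 s) (at s)"
    and w: "\<And>s. s \<in> I \<Longrightarrow> (w has_real_derivative w1 s) (at s)"
    and w1: "\<And>s. s \<in> I \<Longrightarrow> (w1 has_real_derivative w2 s) (at s)"
    and \<alpha>: "\<And>s. s \<in> I \<Longrightarrow> (\<alpha> has_real_derivative \<alpha>1 s) (at s)"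
    and \<alpha>1: "\<And>s. s \<in> I \<Longrightarrow> (\<alpha>1 has_real_derivative \<alpha>2 s) (at s)"
    and h_nonzero: "\<And>s. s \<in> I \<Longrightarrow> h s \<noteq> 0"
    and h1_nonzero: "\<And>s. s \<in> I \<Longrightarrow> h1 s \<noteq> 0"
    and \<alpha>_nonzero: "\<And>s. s \<in> I \<Longrightarrow> \<alpha> s \<noteq> 0"
    and orthogonal: "\<And>s. s \<in> I \<Longrightarrow> w1 s * (\<alpha> s)\<^sup>2 = \<epsilon> * h1 s"
begin

lemma \<epsilon>_square [simp]: "\<epsilon> * \<epsilon> = 1" "\<epsilon> * (\<epsilon> * y) = y" "\<epsilon> \<noteq> 0"
  using \<epsilon> by auto

lemma orthogonal_derivative:
  assumes "s \<in> I"
  shows "w2 s * (\<alpha> s)\<^sup>2 + 2 * w1 s * \<alpha> s * \<alpha>1 s = \<epsilon> * h2 s"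
proof -
  have "((\<lambda>r. w1 r * (\<alpha> r)\<^sup>2 - \<epsilon> * h1 r) has_real_derivative
      w2 s * (\<alpha> s)\<^sup>2 + 2 * w1 s * \<alpha> s * \<alpha>1 s - \<epsilon> * h2 s) (at s)"
    using assms by (auto intro!: derivative_eq_intros w1 \<alpha> h1)
  from derivative_of_zero[OF I(1) assms _ this] orthogonal show ?thesis
    by simp
qed

lemma partial_x:
  assumes "s \<in> I"
  shows "partial 1 x s t = null_orbit (h1 s) (w1 s) t"
    and "partial 2 x s t = null_vec (h s) 0 (2 * t * h s)"
  by (rule partial_1_eqI[OF I(1) assms], rule x)
    (intro has_vector_derivative_null_orbit h w assms,
      rule partial_2_eqI, rule x, rule has_vector_derivative_null_orbit_parameter)

lemma partial_partial_x:
  assumes "s \<in> I"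
  shows "partial 1 (partial 1 x) s t = null_orbit (h2 s) (w2 s) t"
    and "partial 2 (partial 1 x) s t = null_vec (h1 s) 0 (2 * t * h1 s)"
    and "partial 2 (partial 2 x) s t = null_vec 0 0 (2 * h s)"
proof -
  show "partial 1 (partial 1 x) s t = null_orbit (h2 s) (w2 s) t"
    by (rule partial_1_eqI[OF I(1) assms], erule partial_x(1))
      (intro has_vector_derivative_null_orbit h1 w1 assms)
  show "partial 2 (partial 1 x) s t = null_vec (h1 s) 0 (2 * t * h1 s)"
    by (rule partial_2_eqI, rule partial_x(1)[OF assms])
      (rule has_vector_derivative_null_orbit_parameter)
  show "partial 2 (partial 2 x) s t = null_vec 0 0 (2 * h s)"
    by (rule partial_2_eqI, rule partial_x(2)[OF assms], rule has_vector_derivative_null_vec)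
      (auto intro!: derivative_eq_intros)
qed

lemma first_form:
  assumes "s \<in> I"
  shows "first_form x s t $ 1 $ 1 = - h1 s * w1 s"
    and "first_form x s t $ 1 $ 2 = 0"
    and "first_form x s t $ 2 $ 2 = (h s)\<^sup>2"
  using assms
  by (simp_all add: first_form_def partial_x lorentz_null_orbit lorentz_null_orbit_tangent
      lorentz_null_vec power2_eq_square)

lemma second_form:
  assumes "s \<in> I"
  shows "second_form x n s t $ 1 $ 1 = w1 s * \<alpha>1 s"
    and "second_form x n s t $ 1 $ 2 = 0"
    and "second_form x n s t $ 2 $ 2 = - h s * \<alpha> s"
proof -
  have "\<epsilon> * h2 s - w2 s * (\<alpha> s)\<^sup>2 = 2 * (w1 s * \<alpha>1 s) * \<alpha> s"
    using orthogonal_derivative[OF assms] by (simp add: algebra_simps)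
  then show "second_form x n s t $ 1 $ 1 = w1 s * \<alpha>1 s"
    using \<alpha>_nonzero[OF assms] assms
    by (simp add: second_form_def partial_partial_x n lorentz_null_orbit field_simps power2_eq_square)
  show "second_form x n s t $ 1 $ 2 = 0" "second_form x n s t $ 2 $ 2 = - h s * \<alpha> s"
    using assms by (simp_all add: second_form_def partial_partial_x n lorentz_null_orbit_tangent
        null_orbit_def lorentz_null_vec)
qed

lemma w1_nonzero:
  assumes "s \<in> I"
  shows "w1 s \<noteq> 0"
  using orthogonal[OF assms] h1_nonzero[OF assms] by auto

text \<open>\<open>\<alpha>'\<close> vanishes exactly at the parabolic points, so without them \<open>\<alpha>\<close> is a regular parameter.\<close>

lemma no_parabolic_points_iff:
  "no_parabolic_points_on (I \<times> UNIV) x n \<longleftrightarrow> (\<forall>s\<in>I. \<alpha>1 s \<noteq> 0)"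
  using w1_nonzero h_nonzero \<alpha>_nonzero by (auto simp: no_parabolic_points_on_def second_form)

text \<open>Minimality means that \<open>h \<alpha>\<close> is constant.\<close>

lemma zero_mean_curvature_iff:
  "zero_mean_curvature_on (I \<times> UNIV) x n \<longleftrightarrow> (\<forall>s\<in>I. h1 s * \<alpha> s + h s * \<alpha>1 s = 0)"
proof -
  have "- h1 s * w1 s * (- h s * \<alpha> s) - 2 * 0 * 0 + (h s)\<^sup>2 * (w1 s * \<alpha>1 s)
      = h s * w1 s * (h1 s * \<alpha> s + h s * \<alpha>1 s)" for s
    by (simp add: power2_eq_square algebra_simps)
  then show ?thesis
    using w1_nonzero h_nonzero by (auto simp: zero_mean_curvature_on_def first_form second_form)
qed

lemma partial_n:
  assumes "s \<in> I"
  shows "partial 1 n s t = null_orbit (\<alpha>1 s) (\<epsilon> * \<alpha>1 s / (\<alpha> s)\<^sup>2) t"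
    and "partial 2 n s t = null_vec (\<alpha> s) 0 (2 * t * \<alpha> s)"
proof -
  show "partial 1 n s t = null_orbit (\<alpha>1 s) (\<epsilon> * \<alpha>1 s / (\<alpha> s)\<^sup>2) t"
  proof (rule partial_1_eqI[OF I(1) assms], erule n)
    show "((\<lambda>r. null_orbit (\<alpha> r) (- \<epsilon> / \<alpha> r) t) has_vector_derivative
        null_orbit (\<alpha>1 s) (\<epsilon> * \<alpha>1 s / (\<alpha> s)\<^sup>2) t) (at s)"
      using assms \<alpha>_nonzero
      by (auto intro!: has_vector_derivative_null_orbit \<alpha> derivative_eq_intros
          simp: power2_eq_square)
  qed
  show "partial 2 n s t = null_vec (\<alpha> s) 0 (2 * t * \<alpha> s)"
    by (rule partial_2_eqI, rule n[OF assms]) (rule has_vector_derivative_null_orbit_parameter)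
qed

lemma third_form:
  assumes "s \<in> I"
  shows "third_form n s t $ 1 $ 1 = - \<epsilon> * (\<alpha>1 s)\<^sup>2 / (\<alpha> s)\<^sup>2"
    and "third_form n s t $ 1 $ 2 = 0" "third_form n s t $ 2 $ 1 = 0"
    and "third_form n s t $ 2 $ 2 = (\<alpha> s)\<^sup>2"
  using assms
  by (simp_all add: third_form_def partial_n lorentz_null_orbit lorentz_null_orbit_tangent
      lorentz_null_vec power2_eq_square)

lemma det_third_form:
  assumes "s \<in> I"
  shows "sqrt \<bar>det (third_form n s t)\<bar> = \<bar>\<alpha>1 s\<bar>"
  using \<alpha>_nonzero[OF assms] \<epsilon> by (auto simp: det_2 third_form[OF assms] abs_mult)

end

locale null_rotation_surface_regular_normal = null_rotation_surface +
  assumes \<alpha>1_nonzero: "\<And>s. s \<in> I \<Longrightarrow> \<alpha>1 s \<noteq> 0"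
begin

lemma matrix_inv_third_form:
  assumes "s \<in> I"
  shows "matrix_inv (third_form n s t) $ 1 $ 1 = - \<epsilon> * (\<alpha> s)\<^sup>2 / (\<alpha>1 s)\<^sup>2"
    and "matrix_inv (third_form n s t) $ 2 $ 2 = 1 / (\<alpha> s)\<^sup>2"
    and "matrix_inv (third_form n s t) $ 1 $ 2 = 0" "matrix_inv (third_form n s t) $ 2 $ 1 = 0"
  using matrix_inv_diagonal_2[of "third_form n s t"] \<alpha>_nonzero[OF assms] \<alpha>1_nonzero[OF assms] \<epsilon>
  by (auto simp: third_form[OF assms])

text \<open>In the parameters \<open>(\<alpha>, t)\<close> the third fundamental form is
  \<open>-\<epsilon> d\<alpha>\<^sup>2 / \<alpha>\<^sup>2 + \<alpha>\<^sup>2 dt\<^sup>2\<close> and \<open>\<bar>e\<bar> = 1\<close>. The Laplacian therefore is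
  \<open>\<epsilon> (\<alpha>\<^sup>2 p\<^sub>\<alpha>)\<^sub>\<alpha> - p\<^sub>t\<^sub>t / \<alpha>\<^sup>2\<close>, where \<open>d/d\<alpha>\<close> is \<open>d/ds\<close> divided by \<open>\<alpha>'\<close>. The coordinate functions
  of a null-rotational surface are quadratic in \<open>t\<close>, which makes this case sufficient.\<close>

lemma laplace_III_quadratic:
  assumes s: "s \<in> I"
    and p: "\<And>s t. p s t = u s + t * v s + t\<^sup>2 * z s"
    and u: "\<And>r. r \<in> I \<Longrightarrow> (u has_real_derivative u1 r) (at r)"
    and v: "\<And>r. r \<in> I \<Longrightarrow> (v has_real_derivative v1 r) (at r)"
    and z: "\<And>r. r \<in> I \<Longrightarrow> (z has_real_derivative z1 r) (at r)"
    and u2: "((\<lambda>r. (\<alpha> r)\<^sup>2 * u1 r / \<alpha>1 r) has_real_derivative u2) (at s)"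
    and v2: "((\<lambda>r. (\<alpha> r)\<^sup>2 * v1 r / \<alpha>1 r) has_real_derivative v2) (at s)"
    and z2: "((\<lambda>r. (\<alpha> r)\<^sup>2 * z1 r / \<alpha>1 r) has_real_derivative z2) (at s)"
  shows "laplace_III n p s t = \<epsilon> * (u2 + t * v2 + t\<^sup>2 * z2) / \<alpha>1 s - 2 * z s / (\<alpha> s)\<^sup>2"
proof -
  \<comment> \<open>The absolute value in \<open>\<surd>\<bar>e\<bar> = \<bar>\<alpha>'\<bar>\<close> is harmless: its sign is constant and cancels.\<close>
  have "continuous_on I \<alpha>1"
    using \<alpha>1 by (meson DERIV_isCont continuous_at_imp_continuous_on)
  then obtain \<sigma> where \<sigma>: "\<sigma> = 1 \<or> \<sigma> = -1" "\<And>s. s \<in> I \<Longrightarrow> \<bar>\<alpha>1 s\<bar> = \<sigma> * \<alpha>1 s"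
    using connected_nonzero_constant_sign[OF I(2), of \<alpha>1] \<alpha>1_nonzero by blast
  have p1: "partial 1 p r t = u1 r + t * v1 r + t\<^sup>2 * z1 r" if "r \<in> I" for r t
    by (rule partial_1_eqI[OF I(1) that], rule p)
      (auto intro!: derivative_eq_intros u v z that
        simp: has_real_derivative_iff_has_vector_derivative[symmetric])
  have p2: "partial 2 p r t = v r + 2 * t * z r" for r t
    by (rule partial_2_eqI, rule p)
      (auto intro!: derivative_eq_intros simp: has_real_derivative_iff_has_vector_derivative[symmetric])
  define q where "q k m r t =
    sqrt \<bar>det (third_form n r t)\<bar> * matrix_inv (third_form n r t) $ k $ m * partial k p r t" for k m r t
  have "partial 1 (q 1 1) s t = - \<sigma> * \<epsilon> * (u2 + t * v2 + t\<^sup>2 * z2)"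
  proof (rule partial_1_eqI[OF I(1) s])
    show "q 1 1 r t = - \<sigma> * \<epsilon> * ((\<alpha> r)\<^sup>2 * u1 r / \<alpha>1 r + t * ((\<alpha> r)\<^sup>2 * v1 r / \<alpha>1 r)
        + t\<^sup>2 * ((\<alpha> r)\<^sup>2 * z1 r / \<alpha>1 r))" if "r \<in> I" for r
      using \<alpha>1_nonzero[OF that]
      by (simp add: q_def det_third_form[OF that] matrix_inv_third_form[OF that] p1[OF that]
          \<sigma>(2)[OF that] field_simps power2_eq_square)
    show "((\<lambda>r. - \<sigma> * \<epsilon> * ((\<alpha> r)\<^sup>2 * u1 r / \<alpha>1 r + t * ((\<alpha> r)\<^sup>2 * v1 r / \<alpha>1 r)
        + t\<^sup>2 * ((\<alpha> r)\<^sup>2 * z1 r / \<alpha>1 r))) has_vector_derivative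
        - \<sigma> * \<epsilon> * (u2 + t * v2 + t\<^sup>2 * z2)) (at s)"
      unfolding has_real_derivative_iff_has_vector_derivative[symmetric]
      by (intro DERIV_cmult DERIV_add u2 v2 z2)
  qed
  moreover have "partial 2 (q 2 2) s t = 2 * \<sigma> * \<alpha>1 s * z s / (\<alpha> s)\<^sup>2"
  proof (rule partial_2_eqI)
    show "q 2 2 s r = \<sigma> * \<alpha>1 s / (\<alpha> s)\<^sup>2 * (v s + 2 * r * z s)" for r
      by (simp add: q_def det_third_form[OF s] matrix_inv_third_form[OF s] p2 \<sigma>(2)[OF s])
    have "((\<lambda>r. v s + 2 * r * z s) has_real_derivative 2 * z s) (at t)"
      by (auto intro!: derivative_eq_intros)
    from DERIV_cmult[OF this, of "\<sigma> * \<alpha>1 s / (\<alpha> s)\<^sup>2"]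
    show "((\<lambda>r. \<sigma> * \<alpha>1 s / (\<alpha> s)\<^sup>2 * (v s + 2 * r * z s)) has_vector_derivative
        2 * \<sigma> * \<alpha>1 s * z s / (\<alpha> s)\<^sup>2) (at t)"
      unfolding has_real_derivative_iff_has_vector_derivative[symmetric] by (simp add: mult_ac)
  qed
  moreover have "partial 2 (q 1 2) s t = 0"
    by (rule partial_2_eqI[where q = "\<lambda>_. 0"]) (simp_all add: q_def matrix_inv_third_form[OF s])
  moreover have "partial 1 (q 2 1) s t = 0"
    by (rule partial_1_eqI[OF I(1) s, where q = "\<lambda>_. 0"])
      (simp_all add: q_def matrix_inv_third_form)
  moreover have "laplace_III n p s t = - (1 / (\<sigma> * \<alpha>1 s)) *
      (partial 1 (q 1 1) s t + partial 2 (q 1 2) s t + partial 1 (q 2 1) s t + partial 2 (q 2 2) s t)"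
    unfolding laplace_III_def det_third_form[OF s] \<sigma>(2)[OF s] q_def[abs_def] by (simp add: sum_2)
  ultimately have "laplace_III n p s t = - (1 / (\<sigma> * \<alpha>1 s)) *
      (- \<sigma> * \<epsilon> * (u2 + t * v2 + t\<^sup>2 * z2) + 2 * \<sigma> * \<alpha>1 s * z s / (\<alpha> s)\<^sup>2)"
    by simp
  then show ?thesis
    using \<sigma>(1) \<alpha>1_nonzero[OF s] \<alpha>_nonzero[OF s] by (auto simp: field_simps)
qed

text \<open>\<open>\<alpha>\<^sup>2 dh/d\<alpha>\<close>, the quantity differentiated by the radial part of the Laplacian. In terms of it
  \<open>h'\<close> and \<open>w'\<close> are algebraic, and so is its own derivative when \<open>h\<close> satisfies the eigenvalue
  equation: differentiating an algebraic relation then yields another one.\<close>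

definition flux :: "real \<Rightarrow> real" where
  "flux s = (\<alpha> s)\<^sup>2 * h1 s / \<alpha>1 s"

definition flux1 :: "real \<Rightarrow> real" where
  "flux1 s = deriv flux s"

lemma flux_derivative:
  assumes "s \<in> I"
  shows "(flux has_real_derivative flux1 s) (at s)"
proof -
  have "flux differentiable at s"
    unfolding flux_def[abs_def] real_differentiable_def
    using assms by (auto intro!: derivative_eq_intros \<alpha> h1 \<alpha>1 \<alpha>1_nonzero)
  then show ?thesis
    by (simp add: flux1_def DERIV_deriv_iff_real_differentiable)
qed

lemma h1_eq_flux:
  assumes "s \<in> I"
  shows "h1 s * (\<alpha> s)\<^sup>2 = flux s * \<alpha>1 s"
  using \<alpha>1_nonzero[OF assms] by (simp add: flux_def)

lemma w1_eq_flux: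
  assumes "s \<in> I"
  shows "w1 s * (\<alpha> s)^4 = \<epsilon> * flux s * \<alpha>1 s"
proof -
  have "w1 s * (\<alpha> s)^4 = w1 s * (\<alpha> s)\<^sup>2 * (\<alpha> s)\<^sup>2"
    by (simp add: power_def numeral_eq_Suc)
  then show ?thesis
    using orthogonal[OF assms] h1_eq_flux[OF assms] by simp
qed

text \<open>The profile of \<open>\<Delta>\<^sup>I\<^sup>I\<^sup>I x\<close>, which is again null-rotational: \<open>\<Delta>\<^sup>I\<^sup>I\<^sup>I\<close> is built from the invariant
  metric and hence commutes with null rotations.\<close>

definition laplace_p :: "real \<Rightarrow> real" where
  "laplace_p s = \<epsilon> * flux1 s / \<alpha>1 s"

definition laplace_q :: "real \<Rightarrow> real" where
  "laplace_q s = flux1 s / ((\<alpha> s)\<^sup>2 * \<alpha>1 s) - 2 * flux s / (\<alpha> s)^3 - 2 * h s / (\<alpha> s)\<^sup>2"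

lemma laplace_III_vec_x:
  assumes s: "s \<in> I"
  shows "laplace_III_vec n x s t = null_orbit (laplace_p s) (laplace_q s) t"
proof -
  define k where "k = \<epsilon> * (flux1 s / (\<alpha> s)\<^sup>2 - 2 * flux s * \<alpha>1 s / (\<alpha> s)^3)"
  have fh: "((\<lambda>r. (\<alpha> r)\<^sup>2 * h1 r / \<alpha>1 r) has_real_derivative flux1 s) (at s)"
    using flux_derivative[OF s] unfolding flux_def[abs_def] .
  have fw: "((\<lambda>r. (\<alpha> r)\<^sup>2 * w1 r / \<alpha>1 r) has_real_derivative k) (at s)"
  proof (rule has_field_derivative_transform_within_open[OF _ I(1) s])
    show "((\<lambda>r. \<epsilon> * flux r / (\<alpha> r)\<^sup>2) has_real_derivative k) (at s)"
      using \<alpha>_nonzero[OF s] s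
      by (auto intro!: derivative_eq_intros flux_derivative \<alpha>
          simp: k_def field_simps power2_eq_square power3_eq_cube)
    show "\<epsilon> * flux r / (\<alpha> r)\<^sup>2 = (\<alpha> r)\<^sup>2 * w1 r / \<alpha>1 r" if "r \<in> I" for r
      using w1_eq_flux[OF that] \<alpha>_nonzero[OF that] \<alpha>1_nonzero[OF that]
      by (simp add: field_simps power2_eq_square power4_eq_xxxx)
  qed
  have f0: "((\<lambda>r. (\<alpha> r)\<^sup>2 * 0 / \<alpha>1 r) has_real_derivative 0) (at s)"
    by simp
  have half: "((\<lambda>r. (\<alpha> r)\<^sup>2 * (F r / 2) / \<alpha>1 r) has_real_derivative d / 2) (at s)"
    if "((\<lambda>r. (\<alpha> r)\<^sup>2 * F r / \<alpha>1 r) has_real_derivative d) (at s)" for F d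
    using DERIV_cdivide[OF that, of 2] by (simp add: mult_ac)
  have diff: "((\<lambda>r. (\<alpha> r)\<^sup>2 * (w1 r - h1 r) / \<alpha>1 r) has_real_derivative k - flux1 s) (at s)"
    using DERIV_diff[OF fw fh] by (simp add: algebra_simps diff_divide_distrib)
  have add: "((\<lambda>r. (\<alpha> r)\<^sup>2 * (w1 r + h1 r) / \<alpha>1 r) has_real_derivative k + flux1 s) (at s)"
    using DERIV_add[OF fw fh] by (simp add: algebra_simps add_divide_distrib)
  have 1: "laplace_III n (\<lambda>s t. x s t $ 1) s t
      = \<epsilon> * (0 + t * flux1 s + t\<^sup>2 * 0) / \<alpha>1 s - 2 * 0 / (\<alpha> s)\<^sup>2"
    by (rule laplace_III_quadratic[OF s, where u = "\<lambda>_. 0" and v = h and z = "\<lambda>_. 0"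
          and ?u1.0 = "\<lambda>_. 0" and ?v1.0 = h1 and ?z1.0 = "\<lambda>_. 0"])
      (auto simp: x null_orbit_def intro: h fh f0)
  have 2: "laplace_III n (\<lambda>s t. x s t $ 2) s t
      = \<epsilon> * ((k - flux1 s) / 2 + t * 0 + t\<^sup>2 * (flux1 s / 2)) / \<alpha>1 s - 2 * (h s / 2) / (\<alpha> s)\<^sup>2"
    by (rule laplace_III_quadratic[OF s, where u = "\<lambda>r. (w r - h r) / 2" and v = "\<lambda>_. 0"
          and z = "\<lambda>r. h r / 2" and ?u1.0 = "\<lambda>r. (w1 r - h1 r) / 2" and ?v1.0 = "\<lambda>_. 0"
          and ?z1.0 = "\<lambda>r. h1 r / 2"])
      (simp add: x null_orbit_def field_simps,
        (intro DERIV_cdivide DERIV_diff DERIV_const h w half[OF diff] half[OF fh] f0; assumption)+)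
  have 3: "laplace_III n (\<lambda>s t. x s t $ 3) s t
      = \<epsilon> * ((k + flux1 s) / 2 + t * 0 + t\<^sup>2 * (flux1 s / 2)) / \<alpha>1 s - 2 * (h s / 2) / (\<alpha> s)\<^sup>2"
    by (rule laplace_III_quadratic[OF s, where u = "\<lambda>r. (w r + h r) / 2" and v = "\<lambda>_. 0"
          and z = "\<lambda>r. h r / 2" and ?u1.0 = "\<lambda>r. (w1 r + h1 r) / 2" and ?v1.0 = "\<lambda>_. 0"
          and ?z1.0 = "\<lambda>r. h1 r / 2"])
      (simp add: x null_orbit_def field_simps,
        (intro DERIV_cdivide DERIV_add DERIV_const h w half[OF add] half[OF fh] f0; assumption)+)
  have "\<epsilon> * k / \<alpha>1 s - 2 * h s / (\<alpha> s)\<^sup>2 = laplace_q s"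
    using \<alpha>_nonzero[OF s] \<alpha>1_nonzero[OF s]
    by (simp add: k_def laplace_q_def field_simps)
  moreover have "laplace_III n (\<lambda>s t. x s t $ 2) s t
      = ((\<epsilon> * k / \<alpha>1 s - 2 * h s / (\<alpha> s)\<^sup>2) + t\<^sup>2 * laplace_p s - laplace_p s) / 2"
    using \<alpha>_nonzero[OF s] \<alpha>1_nonzero[OF s]
    unfolding 2 laplace_p_def by (simp add: field_simps)
  moreover have "laplace_III n (\<lambda>s t. x s t $ 3) s t
      = ((\<epsilon> * k / \<alpha>1 s - 2 * h s / (\<alpha> s)\<^sup>2) + t\<^sup>2 * laplace_p s + laplace_p s) / 2"
    using \<alpha>_nonzero[OF s] \<alpha>1_nonzero[OF s]
    unfolding 3 laplace_p_def by (simp add: field_simps)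
  ultimately show ?thesis
    by (simp add: vec_eq_iff forall_3 laplace_III_vec_def 1 null_orbit_def laplace_p_def)
qed

end

section \<open>Matrices acting on null-rotational surfaces\<close>

text \<open>A linear map relating two families of null orbits is determined by comparing coefficients of
  powers of \<open>t\<close>, which leaves the maps that commute with the null rotations: combinations of
  the identity and the nilpotent map \<open>(X, p, q) \<mapsto> (0, 0, p)\<close>. In the forward direction the
  \<open>q\<close>-component alone, the sum of the last two coordinates, gives both relations.\<close>

lemma null_orbit_linear_iff:
  assumes h: "\<And>s. s \<in> I \<Longrightarrow> h s \<noteq> (0::real)"
  shows "(\<exists>A :: real^3^3. \<forall>s\<in>I. \<forall>t. null_orbit (H s) (W s) t = A *v null_orbit (h s) (w s) t)
    \<longleftrightarrow> (\<exists>\<kappa> \<mu>. \<forall>s\<in>I. H s = \<kappa> * h s \<and> W s = \<kappa> * w s + \<mu> * h s)"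
proof
  assume "\<exists>A :: real^3^3. \<forall>s\<in>I. \<forall>t. null_orbit (H s) (W s) t = A *v null_orbit (h s) (w s) t"
  then obtain A :: "real^3^3"
    where A: "\<And>s t. s \<in> I \<Longrightarrow> null_orbit (H s) (W s) t = A *v null_orbit (h s) (w s) t"
    by blast
  define \<kappa> where "\<kappa> = (A$2$2 + A$2$3 + A$3$2 + A$3$3) / 2"
  define \<mu> where "\<mu> = (A$2$3 - A$2$2 + A$3$3 - A$3$2) / 2"
  define \<nu> where "\<nu> = A$2$1 + A$3$1"
  have *: "W s + t\<^sup>2 * H s = \<nu> * (t * h s) + \<mu> * h s + \<kappa> * (w s + t\<^sup>2 * h s)" if "s \<in> I" for s t
  proof -
    have "W s + t\<^sup>2 * H s = null_orbit (H s) (W s) t $ 2 + null_orbit (H s) (W s) t $ 3"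
      by (simp add: null_orbit_def field_simps)
    also have "\<dots> = \<nu> * (t * h s) + \<mu> * h s + \<kappa> * (w s + t\<^sup>2 * h s)"
      unfolding A[OF that] by (simp add: null_orbit_def matrix_vector_mult_def sum_3 \<kappa>_def \<mu>_def
          \<nu>_def field_simps)
    finally show ?thesis .
  qed
  have "H s = \<kappa> * h s \<and> W s = \<kappa> * w s + \<mu> * h s" if "s \<in> I" for s
    using *[OF that, of 0] *[OF that, of 1] *[OF that, of "-1"] by (simp add: algebra_simps)
  then show "\<exists>\<kappa> \<mu>. \<forall>s\<in>I. H s = \<kappa> * h s \<and> W s = \<kappa> * w s + \<mu> * h s"
    by blast
next
  assume "\<exists>\<kappa> \<mu>. \<forall>s\<in>I. H s = \<kappa> * h s \<and> W s = \<kappa> * w s + \<mu> * h s"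
  then obtain \<kappa> \<mu> where *: "\<And>s. s \<in> I \<Longrightarrow> H s = \<kappa> * h s \<and> W s = \<kappa> * w s + \<mu> * h s"
    by blast
  define A :: "real^3^3" where
    "A = vector [vector [\<kappa>, 0, 0], vector [0, \<kappa> - \<mu> / 2, \<mu> / 2], vector [0, - \<mu> / 2, \<kappa> + \<mu> / 2]]"
  have "null_orbit (H s) (W s) t = A *v null_orbit (h s) (w s) t" if "s \<in> I" for s t
    using *[OF that] by (simp add: vec_eq_iff forall_3 matrix_vector_mult_def sum_3 A_def
        null_orbit_def field_simps)
  then show "\<exists>A :: real^3^3. \<forall>s\<in>I. \<forall>t. null_orbit (H s) (W s) t = A *v null_orbit (h s) (w s) t"
    by blast
qed

section \<open>The ordinary differential equations\<close>

context null_rotation_surface_regular_normal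
begin

lemma flux_nonzero:
  assumes "s \<in> I"
  shows "flux s \<noteq> 0"
  using h1_nonzero[OF assms] \<alpha>_nonzero[OF assms] \<alpha>1_nonzero[OF assms] by (simp add: flux_def)

text \<open>The hypotheses are the two conditions of \<open>null_orbit_linear_iff\<close> for
  \<open>\<Delta>\<^sup>I\<^sup>I\<^sup>I x\<close>, with \<open>\<kappa> = \<epsilon> \<nu>\<close>. The first makes the second an algebraic relation between
  \<open>h\<close>, \<open>w\<close>, \<open>\<alpha>\<close> and the flux; differentiating it and eliminating \<open>w\<close> leaves a relation that is
  linear in \<open>h\<close> and the flux.\<close>

lemma eigen_first_derivative:
  assumes H: "\<And>s. s \<in> I \<Longrightarrow> flux1 s = \<nu> * h s * \<alpha>1 s"
    and W: "\<And>s. s \<in> I \<Longrightarrow> laplace_q s = \<epsilon> * \<nu> * w s + \<mu> * h s"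
    and s: "s \<in> I"
  shows "flux s * (4 - \<mu> * (\<alpha> s)\<^sup>2) = 4 * (\<nu> - 1) * h s * \<alpha> s"
proof -
  define G where "G = (\<lambda>r. (\<nu> - 2) * h r * \<alpha> r - 2 * flux r - \<mu> * h r * (\<alpha> r)^3
    - \<epsilon> * \<nu> * w r * (\<alpha> r)^3)"
  have G: "G r = 0" if "r \<in> I" for r
  proof -
    have "laplace_q r * (\<alpha> r)^3 = (\<nu> - 2) * h r * \<alpha> r - 2 * flux r"
      using \<alpha>_nonzero[OF that] \<alpha>1_nonzero[OF that]
      by (simp add: laplace_q_def H[OF that] field_simps power2_eq_square power3_eq_cube)
    then show ?thesis
      by (simp add: W[OF that] G_def algebra_simps)
  qed
  have "(G has_real_derivative (\<nu> - 2) * (h1 s * \<alpha> s + h s * \<alpha>1 s) - 2 * flux1 s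
      - \<mu> * (h1 s * (\<alpha> s)^3 + 3 * h s * (\<alpha> s)\<^sup>2 * \<alpha>1 s)
      - \<epsilon> * \<nu> * (w1 s * (\<alpha> s)^3 + 3 * w s * (\<alpha> s)\<^sup>2 * \<alpha>1 s)) (at s)"
    unfolding G_def using s
    by (auto intro!: derivative_eq_intros h w \<alpha> flux_derivative simp: algebra_simps)
  from derivative_of_zero[OF I(1) s G this]
  have "(\<nu> - 2) * (h1 s * \<alpha> s + h s * \<alpha>1 s) - 2 * flux1 s
      - \<mu> * (h1 s * (\<alpha> s)^3 + 3 * h s * (\<alpha> s)\<^sup>2 * \<alpha>1 s)
      - \<epsilon> * \<nu> * (w1 s * (\<alpha> s)^3 + 3 * w s * (\<alpha> s)\<^sup>2 * \<alpha>1 s) = 0"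
    by simp
  then have "\<alpha>1 s * (flux s * (4 - \<mu> * (\<alpha> s)\<^sup>2) - 4 * (\<nu> - 1) * h s * \<alpha> s) = 0"
    using G[OF s, unfolded G_def] h1_eq_flux[OF s] w1_eq_flux[OF s] H[OF s] \<epsilon>_square(1)
    by algebra
  then show ?thesis
    using \<alpha>1_nonzero[OF s] by simp
qed

text \<open>Differentiating once more gives a second relation that is linear in \<open>h\<close> and the flux.\<close>

lemma eigen_second_derivative:
  assumes H: "\<And>s. s \<in> I \<Longrightarrow> flux1 s = \<nu> * h s * \<alpha>1 s"
    and W: "\<And>s. s \<in> I \<Longrightarrow> laplace_q s = \<epsilon> * \<nu> * w s + \<mu> * h s"
    and s: "s \<in> I"
  shows "h s * \<alpha> s * (4 - \<mu> * \<nu> * (\<alpha> s)\<^sup>2) = flux s * (4 * (\<nu> - 1) + 2 * \<mu> * (\<alpha> s)\<^sup>2)"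
proof -
  define G where "G = (\<lambda>r. flux r * (4 - \<mu> * (\<alpha> r)\<^sup>2) - 4 * (\<nu> - 1) * h r * \<alpha> r)"
  have G: "G r = 0" if "r \<in> I" for r
    using eigen_first_derivative[OF H W that] by (simp add: G_def)
  have "(G has_real_derivative flux1 s * (4 - \<mu> * (\<alpha> s)\<^sup>2) - flux s * (2 * \<mu> * \<alpha> s * \<alpha>1 s)
      - 4 * (\<nu> - 1) * (h1 s * \<alpha> s + h s * \<alpha>1 s)) (at s)"
    unfolding G_def using s
    by (auto intro!: derivative_eq_intros h w \<alpha> flux_derivative simp: algebra_simps)
  from derivative_of_zero[OF I(1) s G this]
  have "flux1 s * (4 - \<mu> * (\<alpha> s)\<^sup>2) - flux s * (2 * \<mu> * \<alpha> s * \<alpha>1 s)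
      - 4 * (\<nu> - 1) * (h1 s * \<alpha> s + h s * \<alpha>1 s) = 0"
    by simp
  then have "\<alpha>1 s * (h s * \<alpha> s * (4 - \<mu> * \<nu> * (\<alpha> s)\<^sup>2)
      - flux s * (4 * (\<nu> - 1) + 2 * \<mu> * (\<alpha> s)\<^sup>2)) = 0"
    using h1_eq_flux[OF s] H[OF s] by algebra
  then show ?thesis
    using \<alpha>1_nonzero[OF s] by simp
qed

text \<open>Both linear relations have the nonzero solution formed by \<open>h \<alpha>\<close> and the flux, so their
  determinant vanishes. It is a polynomial in \<open>\<alpha>\<^sup>2\<close> with constant coefficients, and \<open>\<alpha>\<close> is
  not locally constant: all coefficients are zero.\<close>

lemma eigenvalue_cases:
  assumes H: "\<And>s. s \<in> I \<Longrightarrow> flux1 s = \<nu> * h s * \<alpha>1 s"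
    and W: "\<And>s. s \<in> I \<Longrightarrow> laplace_q s = \<epsilon> * \<nu> * w s + \<mu> * h s"
  shows "\<mu> = 0" "\<nu> = 0 \<or> \<nu> = 2"
proof -
  have poly: "(1 - (\<nu> - 1)\<^sup>2) * 16 + (4 * \<mu> - 12 * \<mu> * \<nu>) * (\<alpha> s)\<^sup>2 + \<mu>\<^sup>2 * \<nu> * ((\<alpha> s)\<^sup>2)\<^sup>2 = 0"
    if s: "s \<in> I" for s
  proof -
    have "flux s * (h s * \<alpha> s) * ((1 - (\<nu> - 1)\<^sup>2) * 16 + (4 * \<mu> - 12 * \<mu> * \<nu>) * (\<alpha> s)\<^sup>2
        + \<mu>\<^sup>2 * \<nu> * ((\<alpha> s)\<^sup>2)\<^sup>2) = 0"
      using eigen_first_derivative[OF H W s] eigen_second_derivative[OF H W s] by algebra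
    then show ?thesis
      using flux_nonzero[OF s] h_nonzero[OF s] \<alpha>_nonzero[OF s] by simp
  qed
  have der: "((\<lambda>r. (\<alpha> r)\<^sup>2) has_real_derivative 2 * \<alpha> s * \<alpha>1 s) (at s)" if "s \<in> I" for s
    using that by (auto intro!: derivative_eq_intros \<alpha>)
  have nz: "2 * \<alpha> s * \<alpha>1 s \<noteq> 0" if "s \<in> I" for s
    using \<alpha>_nonzero[OF that] \<alpha>1_nonzero[OF that] by simp
  have "(1 - (\<nu> - 1)\<^sup>2) * 16 = 0" "4 * \<mu> - 12 * \<mu> * \<nu> = 0" "\<mu>\<^sup>2 * \<nu> = 0"
    by (rule quadratic_vanishing_coefficients[OF I(1,3) der nz poly]; assumption)+
  then show "\<mu> = 0" "\<nu> = 0 \<or> \<nu> = 2"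
    by (auto simp: power2_eq_square algebra_simps)
qed

text \<open>The eigenvalue \<open>\<nu> = 0\<close> makes \<open>h \<alpha>\<close> constant, which is minimality; \<open>\<nu> = 2\<close> makes \<open>h / \<alpha>\<close>
  constant, say \<open>c\<close>, and then \<open>w = -\<epsilon> h / \<alpha>\<^sup>2\<close>, so \<open>h w = -\<epsilon> c\<^sup>2\<close>. Conversely, a constant product \<open>h w\<close>
  forces \<open>w \<alpha>\<^sup>2 = -\<epsilon> h\<close>, hence proportional \<open>h\<close> and \<open>\<alpha>\<close>, and then \<open>\<Delta>\<^sup>I\<^sup>I\<^sup>I x = 2 \<epsilon> x\<close>.\<close>

lemma laplace_eigen_iff:
  "(\<exists>\<kappa> \<mu>. \<forall>s\<in>I. laplace_p s = \<kappa> * h s \<and> laplace_q s = \<kappa> * w s + \<mu> * h s) \<longleftrightarrow>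
    (\<forall>s\<in>I. h1 s * \<alpha> s + h s * \<alpha>1 s = 0) \<or> (\<exists>\<delta>. \<delta> \<noteq> 0 \<and> (\<forall>s\<in>I. h s * w s = - \<delta>))"
  (is "?L \<longleftrightarrow> ?M \<or> ?S")
proof
  assume ?L
  then obtain \<kappa> \<mu> where
    *: "\<And>s. s \<in> I \<Longrightarrow> laplace_p s = \<kappa> * h s" "\<And>s. s \<in> I \<Longrightarrow> laplace_q s = \<kappa> * w s + \<mu> * h s"
    by blast
  define \<nu> where "\<nu> = \<epsilon> * \<kappa>"
  have H: "flux1 s = \<nu> * h s * \<alpha>1 s" if "s \<in> I" for s
  proof -
    have "\<epsilon> * (\<epsilon> * flux1 s) = \<epsilon> * (\<kappa> * h s * \<alpha>1 s)"
      using *(1)[OF that] \<alpha>1_nonzero[OF that] by (simp add: laplace_p_def field_simps)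
    then show ?thesis
      by (simp add: \<nu>_def)
  qed
  have W: "laplace_q s = \<epsilon> * \<nu> * w s + \<mu> * h s" if "s \<in> I" for s
    using *(2)[OF that] by (simp add: \<nu>_def)
  note \<mu> = eigenvalue_cases(1)[OF H W]
  have flux: "flux s = (\<nu> - 1) * h s * \<alpha> s" if "s \<in> I" for s
    using eigen_first_derivative[OF H W that] by (simp add: \<mu> algebra_simps)
  have prod: "h1 s * \<alpha> s = (\<nu> - 1) * h s * \<alpha>1 s" if "s \<in> I" for s
  proof -
    have "\<alpha> s * (h1 s * \<alpha> s) = \<alpha> s * ((\<nu> - 1) * h s * \<alpha>1 s)"
      using h1_eq_flux[OF that] flux[OF that] by algebra
    then show ?thesis
      using \<alpha>_nonzero[OF that] by simp
  qed
  from eigenvalue_cases(2)[OF H W] show "?M \<or> ?S"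
  proof
    assume "\<nu> = 0"
    then show ?thesis
      using prod by simp
  next
    assume "\<nu> = 2"
    have "((\<lambda>r. h r / \<alpha> r) has_real_derivative 0) (at s within I)" if "s \<in> I" for s
      using that \<alpha>_nonzero[OF that] prod[OF that] \<open>\<nu> = 2\<close>
      by (auto intro!: derivative_eq_intros h \<alpha> intro: DERIV_subset)
    then obtain c where c: "\<And>s. s \<in> I \<Longrightarrow> h s / \<alpha> s = c"
      using has_field_derivative_zero_constant[of I "\<lambda>r. h r / \<alpha> r"] I(2)
      by (auto simp: is_interval_convex_1[symmetric] is_interval_connected_1)
    have "h s * w s = - (\<epsilon> * c\<^sup>2)" if "s \<in> I" for s
    proof -
      have "laplace_q s = - 2 * h s / (\<alpha> s)\<^sup>2"
        using \<alpha>_nonzero[OF that] \<alpha>1_nonzero[OF that] \<open>\<nu> = 2\<close> flux[OF that]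
        by (simp add: laplace_q_def H[OF that] field_simps power2_eq_square power3_eq_cube)
      then have "\<epsilon> * w s = - h s / (\<alpha> s)\<^sup>2"
        unfolding W[OF that] using \<open>\<nu> = 2\<close> \<mu> by simp
      moreover have "h s * w s = \<epsilon> * h s * (\<epsilon> * w s)"
        by simp
      ultimately show ?thesis
        unfolding c[OF that, symmetric] by (simp add: power2_eq_square)
    qed
    moreover have "\<epsilon> * c\<^sup>2 \<noteq> 0"
      using I(3) c h_nonzero \<alpha>_nonzero by fastforce
    ultimately show ?thesis
      by blast
  qed
next
  assume "?M \<or> ?S"
  then show ?L
  proof
    assume M: ?M
    have flux: "flux s = - h s * \<alpha> s" if "s \<in> I" for s
    proof -
      have "\<alpha>1 s * (flux s + h s * \<alpha> s) = 0"
        using bspec[OF M that] h1_eq_flux[OF that] by algebra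
      then show ?thesis
        using \<alpha>1_nonzero[OF that] by simp
    qed
    have "flux1 s = 0" if "s \<in> I" for s
    proof -
      have "((\<lambda>r. flux r + h r * \<alpha> r) has_real_derivative flux1 s + (h1 s * \<alpha> s + h s * \<alpha>1 s)) (at s)"
        using that by (auto intro!: derivative_eq_intros flux_derivative h \<alpha>)
      from derivative_of_zero[OF I(1) that _ this] flux bspec[OF M that] show ?thesis
        by simp
    qed
    then have "laplace_p s = 0 * h s \<and> laplace_q s = 0 * w s + 0 * h s" if "s \<in> I" for s
      using \<alpha>_nonzero[OF that] that
      by (simp add: laplace_p_def laplace_q_def flux field_simps power2_eq_square power3_eq_cube)
    then show ?L
      by blast
  next
    assume ?S
    then obtain \<delta> where \<delta>: "\<delta> \<noteq> 0" "\<And>s. s \<in> I \<Longrightarrow> h s * w s = - \<delta>"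
      by blast
    have w: "w s * (\<alpha> s)\<^sup>2 = - \<epsilon> * h s" if "s \<in> I" for s
    proof -
      have "((\<lambda>r. h r * w r + \<delta>) has_real_derivative h1 s * w s + h s * w1 s) (at s)"
        using that by (auto intro!: derivative_eq_intros h w)
      from derivative_of_zero[OF I(1) that _ this] \<delta>(2) have "h1 s * w s + h s * w1 s = 0"
        by simp
      then have "h1 s * (w s * (\<alpha> s)\<^sup>2 + \<epsilon> * h s) = 0"
        using orthogonal[OF that] by algebra
      then show ?thesis
        using h1_nonzero[OF that] by simp
    qed
    have \<delta>\<alpha>: "\<delta> * (\<alpha> s)\<^sup>2 = \<epsilon> * (h s)\<^sup>2" if "s \<in> I" for s
      using w[OF that] \<delta>(2)[OF that] by algebra
    have prod: "h1 s * \<alpha> s = h s * \<alpha>1 s" if "s \<in> I" for s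
    proof -
      have "((\<lambda>r. \<delta> * (\<alpha> r)\<^sup>2 - \<epsilon> * (h r)\<^sup>2) has_real_derivative
          2 * \<delta> * \<alpha> s * \<alpha>1 s - 2 * \<epsilon> * h s * h1 s) (at s)"
        using that by (auto intro!: derivative_eq_intros h \<alpha>)
      from derivative_of_zero[OF I(1) that _ this] \<delta>\<alpha>
      have "2 * \<delta> * \<alpha> s * \<alpha>1 s - 2 * \<epsilon> * h s * h1 s = 0"
        by simp
      then have "\<delta> * \<alpha> s * (h1 s * \<alpha> s - h s * \<alpha>1 s) = 0"
        using \<delta>\<alpha>[OF that] by algebra
      then show ?thesis
        using \<delta>(1) \<alpha>_nonzero[OF that] by simp
    qed
    have flux: "flux s = h s * \<alpha> s" if "s \<in> I" for s
    proof -
      have "\<alpha>1 s * flux s = \<alpha>1 s * (h s * \<alpha> s)"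
        using prod[OF that] h1_eq_flux[OF that] by algebra
      then show ?thesis
        using \<alpha>1_nonzero[OF that] by simp
    qed
    have flux1: "flux1 s = 2 * h s * \<alpha>1 s" if "s \<in> I" for s
    proof -
      have "((\<lambda>r. flux r - h r * \<alpha> r) has_real_derivative flux1 s - (h1 s * \<alpha> s + h s * \<alpha>1 s)) (at s)"
        using that by (auto intro!: derivative_eq_intros flux_derivative h \<alpha>)
      from derivative_of_zero[OF I(1) that _ this] flux prod[OF that] show ?thesis
        by simp
    qed
    have "laplace_p s = 2 * \<epsilon> * h s \<and> laplace_q s = 2 * \<epsilon> * w s + 0 * h s" if "s \<in> I" for s
    proof -
      have "\<epsilon> * w s = - h s / (\<alpha> s)\<^sup>2"
        using w[OF that] \<alpha>_nonzero[OF that] \<epsilon> by (auto simp: field_simps)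
      then show ?thesis
        using \<alpha>_nonzero[OF that] \<alpha>1_nonzero[OF that] flux[OF that] flux1[OF that]
        by (simp add: laplace_p_def laplace_q_def field_simps power2_eq_square power3_eq_cube)
    qed
    then show ?L
      by blast
  qed
qed

end

section \<open>Open pieces of quadrics\<close>

text \<open>On a null orbit the form takes the value \<open>-h w\<close>. A point of the quadric with \<open>p = h s\<close> lies on
  the orbit of \<open>s\<close>, since \<open>X\<close> determines \<open>t\<close> and the equation of the quadric determines \<open>q\<close>.
  So a surface contained in the quadric is the part of it over the open set of values of \<open>h\<close>.\<close>

lemma openin_quadric_null_orbits_iff:
  assumes "open I" "\<And>s. s \<in> I \<Longrightarrow> (h has_real_derivative h1 s) (at s)"
    and "\<And>s. s \<in> I \<Longrightarrow> h s \<noteq> 0" "\<And>s. s \<in> I \<Longrightarrow> h1 s \<noteq> 0"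
    and x: "\<And>s t. x s t = null_orbit (h s) (w s) t"
  shows "openin (top_of_set {p. lorentz p p = \<delta>}) ((\<lambda>(s, t). x s t) ` (I \<times> UNIV))
    \<longleftrightarrow> (\<forall>s\<in>I. h s * w s = - \<delta>)"
proof
  assume "openin (top_of_set {p. lorentz p p = \<delta>}) ((\<lambda>(s, t). x s t) ` (I \<times> UNIV))"
  then have "(\<lambda>(s, t). x s t) ` (I \<times> UNIV) \<subseteq> {p. lorentz p p = \<delta>}"
    by (rule openin_imp_subset)
  then have "lorentz (x s 0) (x s 0) = \<delta>" if "s \<in> I" for s
    using that by fast
  then show "\<forall>s\<in>I. h s * w s = - \<delta>"
    by (simp add: x lorentz_null_orbit) (metis add.inverse_inverse)
next
  assume *: "\<forall>s\<in>I. h s * w s = - \<delta>"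
  have "(\<lambda>(s, t). x s t) ` (I \<times> UNIV)
      = {p. lorentz p p = \<delta>} \<inter> (\<lambda>p. p $ 3 - p $ 2) -` (h ` I)" (is "?X = ?Q")
  proof
    show "?X \<subseteq> ?Q"
      using * by (auto simp: x lorentz_null_orbit) (auto simp: null_orbit_def field_simps)
    show "?Q \<subseteq> ?X"
    proof
      fix y assume y: "y \<in> ?Q"
      obtain X p q where pq: "y = null_vec X p q"
        using null_vec_surj by blast
      have "p \<in> h ` I"
        using y by (simp add: pq field_simps)
      then obtain s where s: "s \<in> I" "p = h s"
        by blast
      have "X\<^sup>2 - h s * q = - h s * w s"
        using y * s by (simp add: pq lorentz_null_vec power2_eq_square field_simps)
      then have "q = w s + (X / h s)\<^sup>2 * h s"
        using assms(3)[OF s(1)] by (simp add: field_simps power2_eq_square)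
      then have "y = x s (X / h s)"
        using assms(3)[OF s(1)] by (simp add: pq x null_orbit_def s(2))
      then show "y \<in> ?X"
        using s(1) by auto
    qed
  qed
  moreover have "open ((\<lambda>p::real^3. p $ 3 - p $ 2) -` (h ` I))"
    using assms by (intro open_vimage open_image_nonzero_derivative[of I h h1] continuous_intros)
  ultimately show "openin (top_of_set {p. lorentz p p = \<delta>}) ((\<lambda>(s, t). x s t) ` (I \<times> UNIV))"
    by (simp add: openin_open_Int)
qed

section \<open>The unit normal field\<close>

text \<open>Non-degeneracy makes \<open>h' w'\<close> nowhere zero; let \<open>\<epsilon>\<close> be its sign. The \<open>p\<close>-component of a unit
  normal has the square \<open>\<epsilon> h' / w'\<close>, which does not depend on \<open>t\<close>, and by continuity it has a
  constant sign. So the normal is as smooth as the profile curve, and null-rotational.\<close>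

lemma null_rotation_surface_of_unit_normal:
  fixes I :: "real set" and f g :: "real \<Rightarrow> real" and n :: "real \<Rightarrow> real \<Rightarrow> real^3"
  defines "x \<equiv> lightlike_revolution f g"
  assumes I: "open I" "connected I" "I \<noteq> {}"
    and f: "smooth_fun_on I f" and g: "smooth_fun_on I g"
    and nz: "\<And>s. s \<in> I \<Longrightarrow> f s - g s \<noteq> 0"
    and nondeg: "nondegenerate_on (I \<times> UNIV) x"
    and normal: "unit_normal_field_on (I \<times> UNIV) x n"
  obtains h1 h2 w w1 w2 \<alpha> \<alpha>1 \<alpha>2 \<epsilon>
  where "null_rotation_surface I (\<lambda>s. f s - g s) h1 h2 w w1 w2 \<alpha> \<alpha>1 \<alpha>2 \<epsilon> x n"
proof -
  define h where "h k s = (deriv ^^ k) f s - (deriv ^^ k) g s" for k s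
  define w where "w k s = (deriv ^^ k) f s + (deriv ^^ k) g s" for k s
  have h: "(h k has_real_derivative h (Suc k) s) (at s)" if "s \<in> I" for k s
    unfolding h_def[abs_def] by (intro DERIV_diff smooth_fun_on_derivatives[OF _ that] f g)
  have w: "(w k has_real_derivative w (Suc k) s) (at s)" if "s \<in> I" for k s
    unfolding w_def[abs_def] by (intro DERIV_add smooth_fun_on_derivatives[OF _ that] f g)
  have cont: "continuous_on I (h k)" "continuous_on I (w k)" for k
    using h w by (meson DERIV_isCont continuous_at_imp_continuous_on)+
  have x: "x s t = null_orbit (h 0 s) (w 0 s) t" for s t
    by (simp add: x_def lightlike_revolution_eq_null_orbit h_def w_def)
  have h0: "h 0 s \<noteq> 0" if "s \<in> I" for s
    using nz[OF that] by (simp add: h_def)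
  have x1: "partial 1 x s t = null_orbit (h 1 s) (w 1 s) t" if "s \<in> I" for s t
    by (rule partial_1_eqI[OF I(1) that], rule x, rule has_vector_derivative_null_orbit)
      (use h[OF that, of 0] w[OF that, of 0] in simp_all)
  have x2: "partial 2 x s t = null_vec (h 0 s) 0 (2 * t * h 0 s)" for s t
    by (rule partial_2_eqI, rule x, rule has_vector_derivative_null_orbit_parameter)
  have hw: "h 1 s * w 1 s \<noteq> 0" if "s \<in> I" for s
  proof -
    have "first_form x s 0 $ 1 $ 1 * first_form x s 0 $ 2 $ 2 - (first_form x s 0 $ 1 $ 2)\<^sup>2 \<noteq> 0"
      using nondeg that by (auto simp: nondegenerate_on_def)
    then show ?thesis
      by (simp add: first_form_def x1[OF that] x2 lorentz_null_orbit null_orbit_def lorentz_null_vec)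
  qed
  have "continuous_on I (\<lambda>s. h 1 s * w 1 s)"
    by (intro continuous_intros cont)
  then obtain \<epsilon> where \<epsilon>: "\<epsilon> = 1 \<or> \<epsilon> = -1" "\<And>s. s \<in> I \<Longrightarrow> \<bar>h 1 s * w 1 s\<bar> = \<epsilon> * (h 1 s * w 1 s)"
    using connected_nonzero_constant_sign[OF I(2)] hw by blast
  \<comment> \<open>The null coordinates of the normal, the last one rotated back to time 0.\<close>
  define p where "p z = n (fst z) (snd z) $ 3 - n (fst z) (snd z) $ 2" for z
  define v where "v s t = n s t $ 3 + n s t $ 2 - t\<^sup>2 * p (s, t)" for s t
  have n: "n s t = null_orbit (p (s, t)) (v s t) t"
    and unit: "\<bar>p (s, t) * v s t\<bar> = 1" and ortho: "h 1 s * v s t = - p (s, t) * w 1 s"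
    if "s \<in> I" for s t
  proof -
    have lor: "lorentz (n s t) (n s t) = 1 \<or> lorentz (n s t) (n s t) = -1"
      "lorentz (n s t) (partial k x s t) = 0" for k
      using normal that by (auto simp: unit_normal_field_on_def)
    show n: "n s t = null_orbit (p (s, t)) (v s t) t"
      using null_orbit_surj_if_orthogonal[OF h0[OF that] lor(2)[of 2, unfolded x2]]
      by (simp add: p_def v_def)
    show "\<bar>p (s, t) * v s t\<bar> = 1"
      using lor(1) by (auto simp: n lorentz_null_orbit mult.commute)
    show "h 1 s * v s t = - p (s, t) * w 1 s"
      using lor(2)[of 1] by (simp add: x1[OF that] n lorentz_null_orbit algebra_simps)
  qed
  have pw: "w 1 s * (p (s, t))\<^sup>2 = \<epsilon> * h 1 s" if "s \<in> I" for s t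
  proof -
    have eq: "p (s, t) * v s t * (h 1 s)\<^sup>2 = - ((p (s, t))\<^sup>2 * (h 1 s * w 1 s))"
      using ortho[OF that, of t] by algebra
    have abs_square: "\<bar>y * z\<^sup>2\<bar> = \<bar>y\<bar> * z\<^sup>2" for y z :: real
      by (simp add: abs_mult)
    have "(h 1 s)\<^sup>2 = \<bar>p (s, t) * v s t * (h 1 s)\<^sup>2\<bar>"
      unfolding abs_square unit[OF that] by simp
    also have "\<dots> = (p (s, t))\<^sup>2 * (\<epsilon> * (h 1 s * w 1 s))"
      unfolding eq abs_minus_cancel mult.commute[of "(p (s, t))\<^sup>2"] abs_square \<epsilon>(2)[OF that] ..
    finally have "h 1 s * (w 1 s * (p (s, t))\<^sup>2 - \<epsilon> * h 1 s) = 0"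
      using \<epsilon>(1) by (auto simp: power2_eq_square algebra_simps)
    then show ?thesis
      using hw[OF that] by simp
  qed
  have p0: "p z \<noteq> 0" if "z \<in> I \<times> UNIV" for z
    using unit[of "fst z" "snd z"] that by auto
  have n_cont: "continuous_on (I \<times> UNIV) (\<lambda>z. n (fst z) (snd z))"
    using normal by (simp add: unit_normal_field_on_def case_prod_beta')
  have p_cont: "continuous_on (I \<times> UNIV) p"
    unfolding p_def[abs_def] by (intro continuous_on_diff continuous_on_component n_cont)
  have U_conn: "connected (I \<times> (UNIV :: real set))"
    by (intro connected_Times I connected_UNIV)
  obtain \<sigma>
    where \<sigma>: "\<sigma> = 1 \<or> \<sigma> = -1" "\<forall>z\<in>I \<times> UNIV. \<bar>p z\<bar> = \<sigma> * p z"
    using connected_nonzero_constant_sign[OF U_conn p_cont] p0 by blast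
  \<comment> \<open>The square of the function \<open>\<alpha>\<close> to be constructed.\<close>
  define \<rho> where "\<rho> s = \<epsilon> * h 1 s / w 1 s" for s
  define \<rho>1 where "\<rho>1 s = \<epsilon> * (h 2 s * w 1 s - h 1 s * w 2 s) / (w 1 s)\<^sup>2" for s
  have \<rho>_pos: "\<rho> s > 0" and p: "p (s, t) = \<sigma> * sqrt (\<rho> s)" if "s \<in> I" for s t
  proof -
    have sq: "(p (s, t))\<^sup>2 = \<rho> s" for t
      using pw[OF that, of t] hw[OF that] by (simp add: \<rho>_def field_simps)
    show "\<rho> s > 0"
      using p0[of "(s, 0)"] that by (simp flip: sq[of 0])
    have "p (s, t) = \<sigma> * \<bar>p (s, t)\<bar>"
      using \<sigma>(1) bspec[OF \<sigma>(2), of "(s, t)"] that by auto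
    then show "p (s, t) = \<sigma> * sqrt (\<rho> s)"
      by (simp flip: sq[of t])
  qed
  define \<alpha> where "\<alpha> s = \<sigma> * sqrt (\<rho> s)" for s
  define \<alpha>1 where "\<alpha>1 s = \<rho>1 s / (2 * \<alpha> s)" for s
  have \<alpha>0: "\<alpha> s \<noteq> 0" if "s \<in> I" for s
    using \<rho>_pos[OF that] \<sigma>(1) by (auto simp: \<alpha>_def)
  have \<rho>: "(\<rho> has_real_derivative \<rho>1 s) (at s)" if "s \<in> I" for s
    unfolding \<rho>_def[abs_def] \<rho>1_def
    using that hw[OF that] h[OF that, of 1] w[OF that, of 1]
    by (auto intro!: derivative_eq_intros simp: numeral_2_eq_2 power2_eq_square algebra_simps)
  have \<alpha>: "(\<alpha> has_real_derivative \<alpha>1 s) (at s)" if "s \<in> I" for s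
    unfolding \<alpha>_def[abs_def] \<alpha>1_def using \<rho>_pos[OF that] \<sigma>(1)
    by (auto intro!: derivative_eq_intros \<rho>[OF that] simp: field_simps)
  have \<rho>1: "\<rho>1 differentiable at s" if "s \<in> I" for s
    unfolding \<rho>1_def[abs_def] real_differentiable_def
    using that hw[OF that] by (auto intro!: derivative_eq_intros h w)
  have "\<alpha>1 differentiable at s" if "s \<in> I" for s
    unfolding \<alpha>1_def[abs_def]
  proof (intro differentiable_divide differentiable_mult differentiable_const \<rho>1 that)
    show "\<alpha> differentiable at s"
      using \<alpha>[OF that] by (auto simp: real_differentiable_def)
    show "2 * \<alpha> s \<noteq> 0"
      using \<alpha>0[OF that] by simp
  qed
  then have \<alpha>1: "(\<alpha>1 has_real_derivative deriv \<alpha>1 s) (at s)" if "s \<in> I" for s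
    using that by (simp add: DERIV_deriv_iff_real_differentiable)
  have "null_rotation_surface I (h 0) (h 1) (h 2) (w 0) (w 1) (w 2) \<alpha> \<alpha>1 (deriv \<alpha>1) \<epsilon> x n"
  proof
    show "n s t = null_orbit (\<alpha> s) (- \<epsilon> / \<alpha> s) t" if "s \<in> I" for s t
    proof -
      have \<alpha>p: "\<alpha> s = p (s, t)"
        using p[OF that] by (simp add: \<alpha>_def)
      have "h 1 s * (v s t * p (s, t) + \<epsilon>) = 0"
        using ortho[OF that, of t] pw[OF that, of t] by algebra
      then have "v s t * p (s, t) = - \<epsilon>"
        using hw[OF that] by simp
      then have "v s t = - \<epsilon> / \<alpha> s"
        using \<alpha>0[OF that] unfolding \<alpha>p by (simp add: field_simps)
      then show ?thesis
        using n[OF that, of t] by (simp add: \<alpha>p)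
    qed
    show "w 1 s * (\<alpha> s)\<^sup>2 = \<epsilon> * h 1 s" if "s \<in> I" for s
      using pw[OF that, of 0] p[OF that, of 0] by (simp add: \<alpha>_def)
    show "h 1 s \<noteq> 0" if "s \<in> I" for s
      using hw[OF that] by simp
    show "(h 0 has_real_derivative h 1 s) (at s)" "(w 0 has_real_derivative w 1 s) (at s)"
      if "s \<in> I" for s
      using h[OF that, of 0] w[OF that, of 0] by simp_all
    show "(h 1 has_real_derivative h 2 s) (at s)" "(w 1 has_real_derivative w 2 s) (at s)"
      if "s \<in> I" for s
      using h[OF that, of 1] w[OF that, of 1] by (simp_all add: numeral_2_eq_2)
  qed (use I \<epsilon>(1) x h0 \<alpha> \<alpha>1 \<alpha>0 in auto)
  moreover have "h 0 = (\<lambda>s. f s - g s)"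
    by (simp add: h_def fun_eq_iff)
  ultimately show thesis
    using that by simp
qed

section \<open>Surfaces with linear third Laplacian\<close>

theorem theorem3:
  fixes a b :: ereal
    and f g :: "real \<Rightarrow> real"
    and n :: "real \<Rightarrow> real \<Rightarrow> real^3"
  defines "x \<equiv> lightlike_revolution f g"
    and "U \<equiv> einterval a b \<times> (UNIV :: real set)"
  assumes "a < b"
    and "smooth_fun_on (einterval a b) f"
    and "smooth_fun_on (einterval a b) g"
    and "\<forall>s\<in>einterval a b. f s - g s \<noteq> 0"
    and "nondegenerate_on U x"
    and "unit_normal_field_on U x n"
    and "no_parabolic_points_on U x n"
  shows "(\<exists>A :: real^3^3. \<forall>(s, t)\<in>U. laplace_III_vec n x s t = A *v x s t) \<longleftrightarrow>
         zero_mean_curvature_on U x n \<or>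
         (\<exists>c>0. openin (top_of_set (pseudosphere c)) ((\<lambda>(s, t). x s t) ` U)) \<or>
         (\<exists>c>0. openin (top_of_set (hyperbolic_space c)) ((\<lambda>(s, t). x s t) ` U))"
proof -
  define I where "I = einterval a b"
  have "open I" "I \<noteq> {}"
    using einterval_nonempty[OF \<open>a < b\<close>] by (auto simp: I_def)
  have "is_interval I"
    unfolding is_interval_1
  proof (intro ballI allI impI)
    fix p q r assume "p \<in> I" "q \<in> I" "p \<le> r \<and> r \<le> q"
    then show "r \<in> I"
      using less_le_trans[of a "ereal p" "ereal r"] le_less_trans[of "ereal r" "ereal q" b]
      by (simp add: I_def einterval_iff)
  qed
  then have "connected I"
    by (simp add: is_interval_connected)
  obtain h1 h2 w w1 w2 \<alpha> \<alpha>1 \<alpha>2 \<epsilon>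
    where "null_rotation_surface I (\<lambda>s. f s - g s) h1 h2 w w1 w2 \<alpha> \<alpha>1 \<alpha>2 \<epsilon> x n"
    using null_rotation_surface_of_unit_normal[OF \<open>open I\<close> \<open>connected I\<close> \<open>I \<noteq> {}\<close>, of f g n] assms
    unfolding I_def by blast
  then interpret null_rotation_surface I "\<lambda>s. f s - g s" h1 h2 w w1 w2 \<alpha> \<alpha>1 \<alpha>2 \<epsilon> x n .
  have U: "U = I \<times> UNIV"
    by (simp add: U_def I_def)
  interpret null_rotation_surface_regular_normal I "\<lambda>s. f s - g s" h1 h2 w w1 w2 \<alpha> \<alpha>1 \<alpha>2 \<epsilon> x n
    by unfold_locales
      (use \<open>no_parabolic_points_on U x n\<close> in \<open>simp add: U no_parabolic_points_iff\<close>)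
  have quadric: "openin (top_of_set {p. lorentz p p = \<delta>}) ((\<lambda>(s, t). x s t) ` U)
      \<longleftrightarrow> (\<forall>s\<in>I. (f s - g s) * w s = - \<delta>)" for \<delta>
    unfolding U by (rule openin_quadric_null_orbits_iff[OF I(1) h h_nonzero h1_nonzero x])
  have "(\<exists>A :: real^3^3. \<forall>(s, t)\<in>U. laplace_III_vec n x s t = A *v x s t) \<longleftrightarrow>
      (\<exists>A :: real^3^3. \<forall>s\<in>I. \<forall>t. null_orbit (laplace_p s) (laplace_q s) t
        = A *v null_orbit (f s - g s) (w s) t)"
    by (simp add: U laplace_III_vec_x x)
  also have "\<dots> \<longleftrightarrow> zero_mean_curvature_on U x n \<or>
      (\<exists>\<delta>. \<delta> \<noteq> 0 \<and> openin (top_of_set {p. lorentz p p = \<delta>}) ((\<lambda>(s, t). x s t) ` U))"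
    unfolding quadric unfolding U zero_mean_curvature_iff
    by (subst null_orbit_linear_iff[OF h_nonzero]) (assumption, rule laplace_eigen_iff)
  also have "(\<exists>\<delta>. \<delta> \<noteq> 0 \<and> openin (top_of_set {p. lorentz p p = \<delta>}) ((\<lambda>(s, t). x s t) ` U)) \<longleftrightarrow>
      (\<exists>c>0. openin (top_of_set (pseudosphere c)) ((\<lambda>(s, t). x s t) ` U)) \<or>
      (\<exists>c>0. openin (top_of_set (hyperbolic_space c)) ((\<lambda>(s, t). x s t) ` U))"
    (is "(\<exists>\<delta>. \<delta> \<noteq> 0 \<and> ?Q \<delta>) \<longleftrightarrow> _")
  proof -
    have "(\<exists>\<delta>. \<delta> \<noteq> 0 \<and> ?Q \<delta>) \<longleftrightarrow> (\<exists>c>0. ?Q (c\<^sup>2)) \<or> (\<exists>c>0. ?Q (- (c\<^sup>2)))"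
    proof
      assume "\<exists>\<delta>. \<delta> \<noteq> 0 \<and> ?Q \<delta>"
      then obtain \<delta> where \<delta>: "\<delta> \<noteq> 0" "?Q \<delta>"
        by blast
      define c where "c = sqrt \<bar>\<delta>\<bar>"
      have c: "c > 0"
        using \<delta>(1) by (simp add: c_def)
      have "\<delta> = c\<^sup>2 \<or> \<delta> = - (c\<^sup>2)"
        by (auto simp: c_def)
      then show "(\<exists>c>0. ?Q (c\<^sup>2)) \<or> (\<exists>c>0. ?Q (- (c\<^sup>2)))"
        using c \<delta>(2) by (elim disjE) (simp_all only:, blast+)
    next
      assume "(\<exists>c>0. ?Q (c\<^sup>2)) \<or> (\<exists>c>0. ?Q (- (c\<^sup>2)))"
      then obtain c where "c > 0" "?Q (c\<^sup>2) \<or> ?Q (- (c\<^sup>2))"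
        by blast
      moreover from \<open>c > 0\<close> have "c\<^sup>2 \<noteq> 0" "- (c\<^sup>2) \<noteq> 0"
        by simp_all
      ultimately show "\<exists>\<delta>. \<delta> \<noteq> 0 \<and> ?Q \<delta>"
        by blast
    qed
    then show ?thesis
      by (simp only: pseudosphere_def hyperbolic_space_def)
  qed
  finally show ?thesis .
qed

end
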